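(* Let $A=(A_{ij})_{i,j=1}^n$ be the adjacency matrix of an undirected graph without self-loops on $\{1,\dots,n\}$, with degrees $d_i=\sum_{j\neq i}A_{ij}$ and number of edges $d_+=\sum_{i<j}A_{ij}$. For $s\in\{1,\dots,n-1\}$ let $$(\hat\mu(s),\hat{\boldsymbol\beta}(s))=\operatorname*{argmin}_{\mu\in\mathbb R,\ \boldsymbol\beta\in[0,\infty)^n}\ \ell_n(\mu,\boldsymbol\beta)\quad\text{subject to}\quad \|\boldsymbol\beta\|_0\le s$$ (any global optimal solution), where $$\ell_n(\mu,\boldsymbol\beta)=-d_+\mu-\sum_{i=1}^n d_i\beta_i+\sum_{1\le i<j\le n}\log\left(1+e^{\mu+\beta_i+\beta_j}\right),$$ and write $\hat{\boldsymbol\beta}(s)=(\hat\beta_1(s),\dots,\hat\beta_n(s))^T$. Let $d_{(1)}>d_{(2)}>\cdots>d_{(m)}$ be the distinct values of the $d_i$'s, and let $S_k=\{i\in\{1,\dots,n\}: d_i=d_{(k)}\}$ and $s_k=|S_k|$. Then: (i) If $d_i<d_j$, then $\hat\beta_i(s)\le\hat\beta_j(s)$ for any $s<n$. (ii) If $d_i=d_j$, then $\hat\beta_i(s)=\hat\beta_j(s)$ for any $s$ such that $s=\sum_{k=1}^K s_k$ for some $K\le m-1$.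
   Context: $\|\boldsymbol\beta\|_0$ denotes the number of nonzero entries of $\boldsymbol\beta$. The function $\ell_n$ is the negative log-likelihood of the sparse $\beta$-model, in which $(A_{ij})_{i<j}$ are independent Bernoulli variables with $P(A_{ij}=1)=e^{\mu+\beta_i+\beta_j}/(1+e^{\mu+\beta_i+\beta_j})$. *)

theory Defs
  imports Complex_Main
begin

text \<open>
  An \<open>n \<times> n\<close> matrix and a vector in \<open>\<real>\<^sup>n\<close> are functions on \<^typ>\<open>nat\<close> of which only the entries with
  indices in \<open>{1..n}\<close> are ever used; nothing is assumed about the values elsewhere.
\<close>

definition adjacency_matrix :: "nat \<Rightarrow> (nat \<Rightarrow> nat \<Rightarrow> nat) \<Rightarrow> bool" where
  "adjacency_matrix n A \<longleftrightarrow>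
     (\<forall>i\<in>{1..n}. \<forall>j\<in>{1..n}. A i j \<in> {0, 1} \<and> A i j = A j i) \<and> (\<forall>i\<in>{1..n}. A i i = 0)"

definition deg :: "nat \<Rightarrow> (nat \<Rightarrow> nat \<Rightarrow> nat) \<Rightarrow> nat \<Rightarrow> nat" where
  "deg n A i = (\<Sum>j\<in>{1..n} - {i}. A i j)"

definition num_edges :: "nat \<Rightarrow> (nat \<Rightarrow> nat \<Rightarrow> nat) \<Rightarrow> nat" where
  "num_edges n A = (\<Sum>i=1..n. \<Sum>j=i+1..n. A i j)"

definition l0_norm :: "nat \<Rightarrow> (nat \<Rightarrow> real) \<Rightarrow> nat" where
  "l0_norm n \<beta> = card {i\<in>{1..n}. \<beta> i \<noteq> 0}"

definition neg_log_lik :: "nat \<Rightarrow> (nat \<Rightarrow> nat \<Rightarrow> nat) \<Rightarrow> real \<Rightarrow> (nat \<Rightarrow> real) \<Rightarrow> real" where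
  "neg_log_lik n A \<mu> \<beta> =
     - real (num_edges n A) * \<mu> - (\<Sum>i=1..n. real (deg n A i) * \<beta> i)
     + (\<Sum>i=1..n. \<Sum>j=i+1..n. ln (1 + exp (\<mu> + \<beta> i + \<beta> j)))"

text \<open>
  A minimiser need neither exist (for the graph without edges the infimum is not attained) nor be
  unique, so being a global optimal solution is a predicate on \<open>(\<mu>, \<beta>)\<close>.
\<close>

definition constrained_mle ::
  "nat \<Rightarrow> (nat \<Rightarrow> nat \<Rightarrow> nat) \<Rightarrow> nat \<Rightarrow> real \<Rightarrow> (nat \<Rightarrow> real) \<Rightarrow> bool" where
  "constrained_mle n A s \<mu> \<beta> \<longleftrightarrow>
     is_arg_min (\<lambda>(\<mu>, \<beta>). neg_log_lik n A \<mu> \<beta>)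
       (\<lambda>(\<mu>, \<beta>). (\<forall>i\<in>{1..n}. 0 \<le> \<beta> i) \<and> l0_norm n \<beta> \<le> s) (\<mu>, \<beta>)"

definition num_deg_values :: "nat \<Rightarrow> (nat \<Rightarrow> nat \<Rightarrow> nat) \<Rightarrow> nat" where
  "num_deg_values n A = card (deg n A ` {1..n})"

text \<open>The \<open>k\<close>-th largest degree value; meaningful for \<open>1 \<le> k \<le> num_deg_values n A\<close>.\<close>

definition deg_value :: "nat \<Rightarrow> (nat \<Rightarrow> nat \<Rightarrow> nat) \<Rightarrow> nat \<Rightarrow> nat" where
  "deg_value n A k = rev (sorted_list_of_set (deg n A ` {1..n})) ! (k - 1)"

definition deg_class :: "nat \<Rightarrow> (nat \<Rightarrow> nat \<Rightarrow> nat) \<Rightarrow> nat \<Rightarrow> nat set" where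
  "deg_class n A k = {i\<in>{1..n}. deg n A i = deg_value n A k}"

end

theory Submission
  imports Defs
begin

text \<open>
  Both claims compare the minimiser \<open>\<beta>\<close> with a vector \<open>\<beta>'\<close> obtained from it by changing only two
  entries \<open>i\<close> and \<open>j\<close> without changing \<open>\<beta> i + \<beta> j\<close>. In such a comparison the edge term of the pair
  \<open>{i, j}\<close> and all terms away from \<open>i\<close> and \<open>j\<close> cancel; what remains is the linear part and, for
  every third vertex \<open>k\<close>, the function \<open>x \<mapsto> ln (1 + exp (\<mu> + x + \<beta> k))\<close> at the two entries
  (\<open>neg_log_lik_diff\<close>).

  For (i), \<open>\<beta>'\<close> is \<open>\<beta>\<close> with the two entries swapped. The sums over third vertices agree, so only
  the linear part is affected, and a larger parameter at a vertex of smaller degree is never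
  optimal (\<open>constrained_mle_mono_deg\<close>).

  For (ii), \<open>\<beta>'\<close> has both entries replaced by their mean. If \<open>deg i = deg j\<close>, the linear part is
  unchanged and strict convexity lowers the loss as soon as a third vertex exists. Hence two
  different parameters at vertices of equal degree are possible only if averaging violates the
  sparsity constraint, that is, if one of them is zero, the other is not, and the support has
  exactly \<open>s\<close> elements (\<open>constrained_mle_unequal_imp\<close>). By (i), such a support contains every vertex
  of larger degree and no vertex of smaller degree, so it splits a degree class. The number \<open>s\<close>,
  however, is the size of a union \<open>T\<close> of top degree classes, and \<open>T\<close> either contains the whole
  closed upper set \<open>deg \<ge> deg i\<close>, which is strictly larger than the support, or lies inside the open
  one \<open>deg > deg i\<close>, which is strictly smaller.
\<close>

section \<open>The loss as a function of two parameters\<close>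

text \<open>
  Summing over ordered pairs makes the vertices interchangeable, so that any two of them can be
  split off.
\<close>

lemma sum_ordered_pairs:
  fixes h :: "nat \<Rightarrow> nat \<Rightarrow> real"
  assumes "\<And>a b. h a b = h b a"
  shows "(\<Sum>a=1..n. \<Sum>b\<in>{1..n} - {a}. h a b) = 2 * (\<Sum>a=1..n. \<Sum>b=a+1..n. h a b)"
proof -
  have "(\<Sum>b\<in>{1..n} - {a}. h a b) = (\<Sum>b=a+1..n. h a b) + (\<Sum>b=1..<a. h a b)"
    if "a \<in> {1..n}" for a
  proof -
    have "{1..n} - {a} = {a+1..n} \<union> {1..<a}" using that by auto
    moreover have "{a+1..n} \<inter> {1..<a} = {}" by auto
    ultimately show ?thesis by (simp only: sum.union_disjoint finite_atLeastAtMost finite_atLeastLessThan)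
  qed
  hence "(\<Sum>a=1..n. \<Sum>b\<in>{1..n} - {a}. h a b) =
      (\<Sum>a=1..n. \<Sum>b=a+1..n. h a b) + (\<Sum>a=1..n. \<Sum>b=1..<a. h a b)"
    by (simp add: sum.distrib)
  moreover have "(\<Sum>a=1..n. \<Sum>b=1..<a. h a b) = (\<Sum>b=1..n. \<Sum>a=b+1..n. h a b)"
    unfolding sum.Sigma[OF finite_atLeastAtMost ballI[OF finite_atLeastAtMost]]
      sum.Sigma[OF finite_atLeastAtMost ballI[OF finite_atLeastLessThan]]
    by (rule sum.reindex_bij_witness[where i = "\<lambda>(a, b). (b, a)" and j = "\<lambda>(a, b). (b, a)"]) auto
  moreover have "\<dots> = (\<Sum>b=1..n. \<Sum>a=b+1..n. h b a)"
    using assms by (intro sum.cong refl)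
  ultimately show ?thesis by simp
qed

lemma sum_ordered_pairs_insert:
  fixes h :: "'a \<Rightarrow> 'a \<Rightarrow> real"
  assumes "finite W" and "x \<notin> W" and "\<And>a b. h a b = h b a"
  shows "(\<Sum>a\<in>insert x W. \<Sum>b\<in>insert x W - {a}. h a b) =
    (\<Sum>a\<in>W. \<Sum>b\<in>W - {a}. h a b) + 2 * (\<Sum>w\<in>W. h x w)"
proof -
  have "(\<Sum>b\<in>insert x W - {a}. h a b) = h x a + (\<Sum>b\<in>W - {a}. h a b)" if "a \<in> W" for a
  proof -
    have "insert x W - {a} = insert x (W - {a})" using assms(2) that by auto
    thus ?thesis using assms by simp
  qed
  moreover have "insert x W - {x} = W" using assms(2) by auto
  ultimately show ?thesis using assms(1,2) by (simp add: sum.distrib)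
qed

lemma sum_pairs_split_two:
  fixes h :: "nat \<Rightarrow> nat \<Rightarrow> real"
  assumes "\<And>a b. h a b = h b a" and "i \<in> {1..n}" "j \<in> {1..n}" "i \<noteq> j"
  shows "(\<Sum>a=1..n. \<Sum>b=a+1..n. h a b) =
    (\<Sum>a\<in>{1..n} - {i, j}. \<Sum>b\<in>{1..n} - {i, j} - {a}. h a b) / 2
    + (\<Sum>k\<in>{1..n} - {i, j}. h i k + h j k) + h i j"
proof -
  let ?R = "{1..n} - {i, j}"
  have V: "{1..n} = insert i (insert j ?R)" using assms(2,3) by auto
  have "2 * (\<Sum>a=1..n. \<Sum>b=a+1..n. h a b) = (\<Sum>a=1..n. \<Sum>b\<in>{1..n} - {a}. h a b)"
    by (rule sum_ordered_pairs[symmetric, OF assms(1)])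
  also have "\<dots> = (\<Sum>a\<in>insert i (insert j ?R). \<Sum>b\<in>insert i (insert j ?R) - {a}. h a b)"
    using V by simp
  also have "\<dots> = (\<Sum>a\<in>insert j ?R. \<Sum>b\<in>insert j ?R - {a}. h a b) + 2 * (\<Sum>w\<in>insert j ?R. h i w)"
    using assms(1,4) by (intro sum_ordered_pairs_insert) auto
  also have "(\<Sum>a\<in>insert j ?R. \<Sum>b\<in>insert j ?R - {a}. h a b) =
      (\<Sum>a\<in>?R. \<Sum>b\<in>?R - {a}. h a b) + 2 * (\<Sum>w\<in>?R. h j w)"
    using assms(1) by (intro sum_ordered_pairs_insert) auto
  also have "(\<Sum>w\<in>insert j ?R. h i w) = h i j + (\<Sum>w\<in>?R. h i w)" by simp
  finally show ?thesis by (simp add: sum.distrib)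
qed

lemma neg_log_lik_diff:
  assumes "i \<in> {1..n}" "j \<in> {1..n}" "i \<noteq> j"
    and agree: "\<And>k. k \<in> {1..n} - {i, j} \<Longrightarrow> \<beta>' k = \<beta> k"
    and same_sum: "\<beta>' i + \<beta>' j = \<beta> i + \<beta> j"
  shows "neg_log_lik n A \<mu> \<beta>' - neg_log_lik n A \<mu> \<beta> =
    real (deg n A i) * (\<beta> i - \<beta>' i) + real (deg n A j) * (\<beta> j - \<beta>' j)
    + ((\<Sum>k\<in>{1..n} - {i, j}. ln (1 + exp (\<mu> + \<beta>' i + \<beta> k)) + ln (1 + exp (\<mu> + \<beta>' j + \<beta> k)))
     - (\<Sum>k\<in>{1..n} - {i, j}. ln (1 + exp (\<mu> + \<beta> i + \<beta> k)) + ln (1 + exp (\<mu> + \<beta> j + \<beta> k))))"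
proof -
  let ?R = "{1..n} - {i, j}"
  define h where "h \<gamma> a b = ln (1 + exp (\<mu> + \<gamma> a + \<gamma> b))" for \<gamma> :: "nat \<Rightarrow> real" and a b
  have h_sym: "h \<gamma> a b = h \<gamma> b a" for \<gamma> a b by (simp add: h_def add_ac)
  have V: "{1..n} = insert i (insert j ?R)" using assms(1,2) by auto
  have linear: "(\<Sum>a=1..n. real (deg n A a) * \<gamma> a) =
      real (deg n A i) * \<gamma> i + real (deg n A j) * \<gamma> j + (\<Sum>a\<in>?R. real (deg n A a) * \<gamma> a)" for \<gamma>
    using assms(3) by (subst V) simp
  have expand: "neg_log_lik n A \<mu> \<gamma> = - real (num_edges n A) * \<mu>
      - (real (deg n A i) * \<gamma> i + real (deg n A j) * \<gamma> j + (\<Sum>a\<in>?R. real (deg n A a) * \<gamma> a))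
      + ((\<Sum>a\<in>?R. \<Sum>b\<in>?R - {a}. h \<gamma> a b) / 2 + (\<Sum>k\<in>?R. h \<gamma> i k + h \<gamma> j k) + h \<gamma> i j)" for \<gamma>
    unfolding neg_log_lik_def linear h_def[symmetric]
    using sum_pairs_split_two[of "h \<gamma>", OF h_sym assms(1-3)] by simp
  have "(\<Sum>a\<in>?R. real (deg n A a) * \<beta>' a) = (\<Sum>a\<in>?R. real (deg n A a) * \<beta> a)"
    using agree by (intro sum.cong) auto
  moreover have "(\<Sum>a\<in>?R. \<Sum>b\<in>?R - {a}. h \<beta>' a b) = (\<Sum>a\<in>?R. \<Sum>b\<in>?R - {a}. h \<beta> a b)"
    using agree by (intro sum.cong) (auto simp: h_def)
  moreover have "h \<beta>' i j = h \<beta> i j"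
    using same_sum by (simp add: h_def add.assoc)
  moreover have "(\<Sum>k\<in>?R. h \<beta>' i k + h \<beta>' j k) =
      (\<Sum>k\<in>?R. ln (1 + exp (\<mu> + \<beta>' i + \<beta> k)) + ln (1 + exp (\<mu> + \<beta>' j + \<beta> k)))"
    using agree by (intro sum.cong) (auto simp: h_def)
  moreover have "(\<Sum>k\<in>?R. h \<beta> i k + h \<beta> j k) =
      (\<Sum>k\<in>?R. ln (1 + exp (\<mu> + \<beta> i + \<beta> k)) + ln (1 + exp (\<mu> + \<beta> j + \<beta> k)))"
    by (simp add: h_def)
  ultimately show ?thesis
    unfolding expand by (simp add: algebra_simps)
qed

text \<open>
  Midpoint form of the strict convexity of \<open>x \<mapsto> ln (1 + exp x)\<close>. After exponentiation it is
  \<open>(u - v)\<^sup>2 > 0\<close> for \<open>u = exp (x / 2)\<close> and \<open>v = exp (y / 2)\<close>.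
\<close>

lemma ln_one_plus_exp_midpoint_less:
  fixes x y :: real
  assumes "x \<noteq> y"
  shows "2 * ln (1 + exp ((x + y) / 2)) < ln (1 + exp x) + ln (1 + exp y)"
proof -
  define u v where "u = exp (x / 2)" and "v = exp (y / 2)"
  have mid: "exp ((x + y) / 2) = u * v"
    by (simp add: u_def v_def add_divide_distrib flip: exp_add)
  have ends: "exp x = u\<^sup>2" "exp y = v\<^sup>2"
    by (simp_all add: u_def v_def flip: exp_double)
  have pos: "u > 0" "v > 0" by (simp_all add: u_def v_def)
  have "u \<noteq> v" using assms by (simp add: u_def v_def)
  hence "(u - v)\<^sup>2 > 0" by simp
  hence less: "(1 + u * v)\<^sup>2 < (1 + u\<^sup>2) * (1 + v\<^sup>2)"
    by (simp add: power2_eq_square algebra_simps)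
  have "1 + u * v > 0" using pos by (simp add: add_pos_pos)
  hence "2 * ln (1 + u * v) = ln ((1 + u * v)\<^sup>2)"
    by (simp add: ln_realpow)
  also have "\<dots> < ln ((1 + u\<^sup>2) * (1 + v\<^sup>2))"
    using less \<open>1 + u * v > 0\<close> by (subst ln_less_cancel_iff) (auto intro: less_trans[OF _ less])
  also have "\<dots> = ln (1 + u\<^sup>2) + ln (1 + v\<^sup>2)"
    by (rule ln_mult_pos) (auto intro: add_pos_nonneg)
  finally show ?thesis by (simp add: mid ends)
qed

section \<open>Minimisers and degrees\<close>

lemma constrained_mle_feasible:
  assumes "constrained_mle n A s \<mu> \<beta>"
  shows "\<forall>i\<in>{1..n}. 0 \<le> \<beta> i" "l0_norm n \<beta> \<le> s"
  using assms by (auto simp: constrained_mle_def is_arg_min_def)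

lemma constrained_mle_le:
  assumes "constrained_mle n A s \<mu> \<beta>"
    and "\<forall>i\<in>{1..n}. 0 \<le> \<beta>' i" and "l0_norm n \<beta>' \<le> s"
  shows "neg_log_lik n A \<mu> \<beta> \<le> neg_log_lik n A \<mu> \<beta>'"
  using assms by (fastforce simp: constrained_mle_def is_arg_min_def not_less)

lemma l0_norm_swap:
  assumes "i \<in> {1..n}" "j \<in> {1..n}"
  shows "l0_norm n (\<beta>(i := \<beta> j, j := \<beta> i)) = l0_norm n \<beta>"
  unfolding l0_norm_def
  by (rule bij_betw_same_card[of "\<lambda>k. if k = i then j else if k = j then i else k"],
      rule bij_betw_byWitness[where f' = "\<lambda>k. if k = i then j else if k = j then i else k"])
    (use assms in \<open>auto split: if_splits\<close>)

text \<open>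
  Swapping two entries changes the loss by \<open>(deg i - deg j) * (\<beta> i - \<beta> j)\<close>, which would be negative
  for a pair violating monotonicity.
\<close>

lemma constrained_mle_mono_deg:
  assumes mle: "constrained_mle n A s \<mu> \<beta>"
    and ij: "i \<in> {1..n}" "j \<in> {1..n}" and less: "deg n A i < deg n A j"
  shows "\<beta> i \<le> \<beta> j"
proof (rule ccontr)
  assume "\<not> \<beta> i \<le> \<beta> j"
  have "i \<noteq> j" using less by auto
  define \<beta>' where "\<beta>' = \<beta>(i := \<beta> j, j := \<beta> i)"
  have "neg_log_lik n A \<mu> \<beta> \<le> neg_log_lik n A \<mu> \<beta>'"
    using constrained_mle_feasible[OF mle] ij l0_norm_swap[OF ij, of \<beta>]
    by (intro constrained_mle_le[OF mle]) (auto simp: \<beta>'_def)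
  moreover have "neg_log_lik n A \<mu> \<beta>' - neg_log_lik n A \<mu> \<beta> =
      (real (deg n A i) - real (deg n A j)) * (\<beta> i - \<beta> j)"
    using \<open>i \<noteq> j\<close> by (subst neg_log_lik_diff[OF ij]) (auto simp: \<beta>'_def algebra_simps)
  moreover have "\<dots> < 0"
    using less \<open>\<not> \<beta> i \<le> \<beta> j\<close> by (intro mult_neg_pos) auto
  ultimately show False by linarith
qed

text \<open>
  The mean of the two entries is strictly better, hence infeasible. It is nonnegative, so it must
  violate the sparsity constraint. This requires that averaging enlarge the support, which it does
  only if exactly one of the entries is zero, and then by one element.
\<close>

lemma constrained_mle_unequal_imp:
  assumes mle: "constrained_mle n A s \<mu> \<beta>"
    and ijk: "i \<in> {1..n}" "j \<in> {1..n}" "k \<in> {1..n} - {i, j}"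
    and same_deg: "deg n A i = deg n A j" and less: "\<beta> j < \<beta> i"
  shows "\<beta> j = 0" and "l0_norm n \<beta> = s"
proof -
  have "i \<noteq> j" using less by auto
  define m where "m = (\<beta> i + \<beta> j) / 2"
  define \<beta>' where "\<beta>' = \<beta>(i := m, j := m)"
  have "\<beta> j \<ge> 0" using constrained_mle_feasible(1)[OF mle] ijk(2) by blast
  hence "\<beta> i > 0" "m > 0" using less by (simp_all add: m_def)
  let ?R = "{1..n} - {i, j}"
  have "neg_log_lik n A \<mu> \<beta>' - neg_log_lik n A \<mu> \<beta> =
      (\<Sum>k\<in>?R. 2 * ln (1 + exp (\<mu> + m + \<beta> k)))
      - (\<Sum>k\<in>?R. ln (1 + exp (\<mu> + \<beta> i + \<beta> k)) + ln (1 + exp (\<mu> + \<beta> j + \<beta> k)))"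
    using \<open>i \<noteq> j\<close> same_deg
    by (subst neg_log_lik_diff[OF ijk(1,2)]) (auto simp: \<beta>'_def m_def field_simps)
  moreover have "(\<Sum>k\<in>?R. 2 * ln (1 + exp (\<mu> + m + \<beta> k))) <
      (\<Sum>k\<in>?R. ln (1 + exp (\<mu> + \<beta> i + \<beta> k)) + ln (1 + exp (\<mu> + \<beta> j + \<beta> k)))"
  proof (rule sum_strict_mono)
    fix k
    have "\<mu> + m + \<beta> k = ((\<mu> + \<beta> i + \<beta> k) + (\<mu> + \<beta> j + \<beta> k)) / 2"
      by (simp add: m_def field_simps)
    thus "2 * ln (1 + exp (\<mu> + m + \<beta> k)) <
        ln (1 + exp (\<mu> + \<beta> i + \<beta> k)) + ln (1 + exp (\<mu> + \<beta> j + \<beta> k))"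
      using ln_one_plus_exp_midpoint_less[of "\<mu> + \<beta> i + \<beta> k" "\<mu> + \<beta> j + \<beta> k"] less
      by (simp only:)
  qed (use ijk(3) in auto)
  ultimately have "neg_log_lik n A \<mu> \<beta>' < neg_log_lik n A \<mu> \<beta>" by linarith
  moreover have "\<forall>k\<in>{1..n}. 0 \<le> \<beta>' k"
    using constrained_mle_feasible(1)[OF mle] \<open>m > 0\<close> by (auto simp: \<beta>'_def)
  ultimately have infeasible: "l0_norm n \<beta>' > s"
    using constrained_mle_le[OF mle, of \<beta>'] by linarith
  have supp: "{k\<in>{1..n}. \<beta>' k \<noteq> 0} = insert j {k\<in>{1..n}. \<beta> k \<noteq> 0}"
    using \<open>\<beta> i > 0\<close> \<open>m > 0\<close> ijk by (auto simp: \<beta>'_def)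
  show "\<beta> j = 0"
  proof (rule ccontr)
    assume "\<beta> j \<noteq> 0"
    hence "insert j {k\<in>{1..n}. \<beta> k \<noteq> 0} = {k\<in>{1..n}. \<beta> k \<noteq> 0}" using ijk(2) by auto
    hence "l0_norm n \<beta>' = l0_norm n \<beta>" by (simp only: l0_norm_def supp)
    thus False using infeasible constrained_mle_feasible(2)[OF mle] by linarith
  qed
  hence "l0_norm n \<beta>' = Suc (l0_norm n \<beta>)" unfolding l0_norm_def supp by simp
  thus "l0_norm n \<beta> = s" using infeasible constrained_mle_feasible(2)[OF mle] by linarith
qed

section \<open>Unions of top degree classes\<close>

lemma deg_value_strict_antimono:
  assumes "1 \<le> k" "k < l" "l \<le> num_deg_values n A"
  shows "deg_value n A l < deg_value n A k"
proof -
  let ?xs = "sorted_list_of_set (deg n A ` {1..n})"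
  have len: "length ?xs = num_deg_values n A" by (simp add: num_deg_values_def)
  have "?xs ! (length ?xs - l) < ?xs ! (length ?xs - k)"
    using assms len by (intro sorted_wrt_nth_less[OF strict_sorted_list_of_set]) auto
  thus ?thesis using assms len by (simp add: deg_value_def rev_nth)
qed

lemma deg_eq_deg_value:
  assumes "i \<in> {1..n}"
  obtains l where "1 \<le> l" "l \<le> num_deg_values n A" "deg n A i = deg_value n A l"
proof -
  let ?xs = "sorted_list_of_set (deg n A ` {1..n})"
  have "deg n A i \<in> set (rev ?xs)" using assms by simp
  then obtain p where "p < length (rev ?xs)" "rev ?xs ! p = deg n A i"
    unfolding in_set_conv_nth by blast
  thus ?thesis by (intro that[of "Suc p"]) (auto simp: deg_value_def num_deg_values_def)
qed

lemma top_deg_classes_upward_closed: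
  assumes "K \<le> num_deg_values n A"
    and i: "i \<in> (\<Union>k\<in>{1..K}. deg_class n A k)"
    and j: "j \<in> {1..n}" and le: "deg n A i \<le> deg n A j"
  shows "j \<in> (\<Union>k\<in>{1..K}. deg_class n A k)"
proof -
  obtain k where k: "k \<in> {1..K}" "deg n A i = deg_value n A k"
    using i by (auto simp: deg_class_def)
  obtain l where l: "1 \<le> l" "l \<le> num_deg_values n A" "deg n A j = deg_value n A l"
    using j by (rule deg_eq_deg_value)
  have "l \<le> k"
    using deg_value_strict_antimono[of k l n A] k l le by fastforce
  thus ?thesis using k(1) l j by (auto simp: deg_class_def intro!: bexI[of _ l])
qed

lemma card_top_deg_classes:
  assumes "K \<le> num_deg_values n A"
  shows "card (\<Union>k\<in>{1..K}. deg_class n A k) = (\<Sum>k=1..K. card (deg_class n A k))"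
proof (rule card_UN_disjoint)
  show "\<forall>k\<in>{1..K}. \<forall>l\<in>{1..K}. k \<noteq> l \<longrightarrow> deg_class n A k \<inter> deg_class n A l = {}"
  proof (intro ballI impI)
    fix k l assume kl: "k \<in> {1..K}" "l \<in> {1..K}" "k \<noteq> l"
    have "deg_value n A k \<noteq> deg_value n A l"
      using deg_value_strict_antimono[of k l n A] deg_value_strict_antimono[of l k n A] kl assms
      by (cases k l rule: linorder_cases) auto
    thus "deg_class n A k \<inter> deg_class n A l = {}" by (auto simp: deg_class_def)
  qed
qed (auto simp: deg_class_def)

text \<open>
  The hypotheses \<open>1 \<le> K\<close> and \<open>K < num_deg_values n A\<close> force at least two degree values. Given two
  vertices of equal degree there is therefore a third vertex, without which the loss would depend
  only on \<open>\<beta> i + \<beta> j\<close> and averaging would gain nothing.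
\<close>

lemma constrained_mle_not_less_on_deg_class:
  assumes mle: "constrained_mle n A s \<mu> \<beta>"
    and K: "1 \<le> K" "K < num_deg_values n A" and s: "s = (\<Sum>k=1..K. card (deg_class n A k))"
    and ij: "i \<in> {1..n}" "j \<in> {1..n}" and same_deg: "deg n A i = deg n A j"
  shows "\<not> \<beta> j < \<beta> i"
proof
  assume less: "\<beta> j < \<beta> i"
  have "\<exists>k\<in>{1..n}. deg n A k \<noteq> deg n A i"
  proof (rule ccontr)
    assume "\<not> (\<exists>k\<in>{1..n}. deg n A k \<noteq> deg n A i)"
    hence "deg n A ` {1..n} \<subseteq> {deg n A i}" by auto
    hence "num_deg_values n A \<le> 1"
      unfolding num_deg_values_def by (metis card_mono card.empty card_insert_disjoint One_nat_def
          empty_iff finite.emptyI finite.insertI)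
    thus False using K by linarith
  qed
  then obtain k where "k \<in> {1..n}" "deg n A k \<noteq> deg n A i" by blast
  hence "k \<in> {1..n} - {i, j}" using same_deg by auto
  note zero = constrained_mle_unequal_imp[OF mle ij this same_deg less]
  define S T where "S = {k\<in>{1..n}. \<beta> k \<noteq> 0}" and "T = (\<Union>k\<in>{1..K}. deg_class n A k)"
  have card_eq: "card S = card T"
    using zero(2) card_top_deg_classes[of K n A] K s by (simp add: S_def T_def l0_norm_def)
  have finite: "finite S" "finite T" by (auto simp: S_def T_def deg_class_def)
  have T_sub: "T \<subseteq> {1..n}" by (auto simp: T_def deg_class_def)
  have T_up: "b \<in> T" if "a \<in> T" "b \<in> {1..n}" "deg n A a \<le> deg n A b" for a b
    using top_deg_classes_upward_closed[of K n A a b] that K unfolding T_def by simp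
  have S_split: "i \<in> S" "j \<notin> S"
    using zero(1) less ij by (auto simp: S_def)
  have larger: "k \<in> S" if "k \<in> {1..n}" "deg n A i < deg n A k" for k
    using constrained_mle_mono_deg[OF mle ij(1) that] that zero(1) less by (auto simp: S_def)
  have smaller: "k \<notin> S" if "k \<in> {1..n}" "deg n A k < deg n A j" for k
    using constrained_mle_mono_deg[OF mle that(1) ij(2) that(2)] that zero(1)
      constrained_mle_feasible(1)[OF mle] by (force simp: S_def)
  show False
  proof (cases "i \<in> T")
    case True
    have "S \<subseteq> T"
    proof
      fix k assume "k \<in> S"
      hence "k \<in> {1..n}" by (simp add: S_def)
      thus "k \<in> T" using T_up[OF True] smaller[of k] \<open>k \<in> S\<close> same_deg by force
    qed
    moreover have "j \<in> T" using T_up[OF True] ij same_deg by simp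
    ultimately have "S \<subset> T" using S_split by blast
    thus False using psubset_card_mono[OF finite(2), of S] card_eq by simp
  next
    case False
    have "T \<subseteq> S"
    proof
      fix k assume "k \<in> T"
      hence "deg n A i < deg n A k" using T_up[of k i] False ij(1) by force
      thus "k \<in> S" using larger \<open>k \<in> T\<close> T_sub by blast
    qed
    hence "T \<subset> S" using S_split False by blast
    thus False using psubset_card_mono[OF finite(1), of T] card_eq by simp
  qed
qed

theorem lemma1:
  fixes n s :: nat and A :: "nat \<Rightarrow> nat \<Rightarrow> nat" and \<mu> :: real and \<beta> :: "nat \<Rightarrow> real"
  assumes "adjacency_matrix n A"
    and "s \<in> {1..n - 1}"
    and "constrained_mle n A s \<mu> \<beta>"
  shows "(\<forall>i\<in>{1..n}. \<forall>j\<in>{1..n}. deg n A i < deg n A j \<longrightarrow> \<beta> i \<le> \<beta> j) \<and>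
    ((\<exists>K \<le> num_deg_values n A - 1. s = (\<Sum>k=1..K. card (deg_class n A k))) \<longrightarrow>
      (\<forall>i\<in>{1..n}. \<forall>j\<in>{1..n}. deg n A i = deg n A j \<longrightarrow> \<beta> i = \<beta> j))"
proof (intro conjI impI ballI)
  fix i j assume "i \<in> {1..n}" "j \<in> {1..n}" "deg n A i < deg n A j"
  thus "\<beta> i \<le> \<beta> j" by (rule constrained_mle_mono_deg[OF assms(3)])
next
  fix i j
  assume "\<exists>K \<le> num_deg_values n A - 1. s = (\<Sum>k=1..K. card (deg_class n A k))"
    and ij: "i \<in> {1..n}" "j \<in> {1..n}" and same_deg: "deg n A i = deg n A j"
  then obtain K where K: "K \<le> num_deg_values n A - 1"
    and s: "s = (\<Sum>k=1..K. card (deg_class n A k))" by blast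
  have "1 \<le> K" using s assms(2) by (cases K) auto
  moreover from this have "K < num_deg_values n A" using K by linarith
  ultimately show "\<beta> i = \<beta> j"
    using constrained_mle_not_less_on_deg_class[OF assms(3) _ _ s ij same_deg]
      constrained_mle_not_less_on_deg_class[OF assms(3) _ _ s ij(2,1) same_deg[symmetric]]
    by force
qed

end
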